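(* Let $n\ge 2$. The continuous endomorphisms of the Einstein gyrogroup $(\mathbb{B}^n,\oplus)$ are precisely the restrictions to $\mathbb{B}^n$ of orthogonal transformations of $\mathbb{R}^n$ and the map that sends everything to $0$. That is, a map $f:\mathbb{B}^n\to\mathbb{B}^n$ is continuous and satisfies $f(u\oplus v)=f(u)\oplus f(v)$ for all $u,v\in\mathbb{B}^n$ if and only if either $f(u)=0$ for all $u\in\mathbb{B}^n$, or there is an orthogonal linear transformation $T:\mathbb{R}^n\to\mathbb{R}^n$ such that $f(u)=T(u)$ for all $u\in\mathbb{B}^n$.
   Context: For a positive integer $n$, $\mathbb{B}^n=\{u\in\mathbb{R}^n: |u|<1\}$ is the open unit ball (with the Euclidean topology), where $(u,v)$ denotes the standard inner product on $\mathbb{R}^n$ and $|u|=\sqrt{(u,u)}$ the Euclidean norm. The $n$-dimensional Einstein gyrogroup is $\mathbb{B}^n$ with the binary operation $$u\oplus v=\frac{1}{1+(u,v)}\left(u+\sqrt{1-|u|^2}\, v+\frac{(u,v)}{1+\sqrt{1-|u|^2}}\, u\right),$$ which maps $\mathbb{B}^n\times\mathbb{B}^n$ to $\mathbb{B}^n$. An endomorphism of $(\mathbb{B}^n,\oplus)$ is a map $f:\mathbb{B}^n\to\mathbb{B}^n$ with $f(u\oplus v)=f(u)\oplus f(v)$ for all $u,v\in\mathbb{B}^n$. *)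

theory Defs
  imports "HOL-Analysis.Analysis"
begin

definition einstein_add :: "real ^ 'n \<Rightarrow> real ^ 'n \<Rightarrow> real ^ 'n"  (infixl "\<oplus>\<^sub>E" 65) where
  "u \<oplus>\<^sub>E v = (1 / (1 + u \<bullet> v)) *\<^sub>R
     (u + sqrt (1 - (norm u)\<^sup>2) *\<^sub>R v + ((u \<bullet> v) / (1 + sqrt (1 - (norm u)\<^sup>2))) *\<^sub>R u)"

text \<open>A self-map of the open unit ball is represented by a total function on the whole space
  that maps the ball into itself; its values outside the ball are irrelevant.\<close>

definition einstein_endomorphism :: "(real ^ 'n \<Rightarrow> real ^ 'n) \<Rightarrow> bool" where
  "einstein_endomorphism f \<longleftrightarrow>
     f \<in> ball 0 1 \<rightarrow> ball 0 1 \<and>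
     (\<forall>u\<in>ball 0 1. \<forall>v\<in>ball 0 1. f (u \<oplus>\<^sub>E v) = f u \<oplus>\<^sub>E f v)"

end

theory Submission
  imports Defs
begin

text \<open>On a line through the origin, \<open>\<oplus>\<^sub>E\<close> is addition of rapidities (the inverse hyperbolic
  tangent of the norm), and near the origin it is vector addition to first order. Hence a
  continuous endomorphism, written in rapidity coordinates, is additive, so it is a linear map
  \<open>A\<close>. For orthogonal \<open>u\<close>, \<open>v\<close>, symmetry of the norm of \<open>u \<oplus>\<^sub>E v\<close> forces \<open>A\<close> to be a multiple
  of an isometry, and comparing the directions of \<open>f (u \<oplus>\<^sub>E v)\<close> and \<open>f u \<oplus>\<^sub>E f v\<close> forces
  the factor to be 0 or 1.\<close>

section \<open>Einstein addition\<close>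

lemma ball_inner_gt:
  fixes u v :: "'a::real_inner"
  assumes "norm u < 1" "norm v < 1"
  shows "0 < 1 + u \<bullet> v"
proof -
  have "\<bar>u \<bullet> v\<bar> \<le> norm u * norm v" by (rule Cauchy_Schwarz_ineq2)
  also have "\<dots> < 1"
    using mult_strict_mono[OF assms] by simp
  finally show ?thesis by linarith
qed

text \<open>This is the multiplicativity of the Lorentz factor, up to
  \<open>1 + u \<bullet> v\<close>. The right-hand side is positive and symmetric in
  \<open>u\<close> and \<open>v\<close>, which yields both closure of the ball and symmetry of the
  norm, although \<open>\<oplus>\<^sub>E\<close> itself is not commutative.\<close>

lemma norm_einstein_add:
  fixes u v :: "real ^ 'n"
  assumes u: "norm u < 1" and v: "norm v < 1"
  shows "1 - (norm (u \<oplus>\<^sub>E v))\<^sup>2 = (1 - (norm u)\<^sup>2) * (1 - (norm v)\<^sup>2) / (1 + u \<bullet> v)\<^sup>2"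
proof -
  define s where "s = sqrt (1 - (norm u)\<^sup>2)"
  define c where "c = (u \<bullet> v) / (1 + s)"
  have "(norm u)\<^sup>2 < 1" using u by (simp add: abs_square_less_1)
  then have s: "0 < s" "s\<^sup>2 = 1 - (norm u)\<^sup>2" by (simp_all add: s_def)
  \<comment> \<open>Writing \<open>u \<bullet> v\<close> and \<open>u \<bullet> u\<close> through
    \<open>c\<close> and \<open>s\<close> removes the square root and the quotient, so the norm
    formula becomes a polynomial identity.\<close>
  have k: "u \<bullet> v = c * (1 + s)" using s by (simp add: c_def)
  have pos: "0 < 1 + u \<bullet> v" using ball_inner_gt[OF u v] .
  have eq: "u \<oplus>\<^sub>E v = (1 / (1 + u \<bullet> v)) *\<^sub>R ((1 + c) *\<^sub>R u + s *\<^sub>R v)"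
    by (simp add: einstein_add_def s_def c_def algebra_simps)
  have uu: "u \<bullet> u = 1 - s\<^sup>2" using s by (simp add: dot_square_norm)
  have "(norm ((1 + c) *\<^sub>R u + s *\<^sub>R v))\<^sup>2
      = (1 + c)\<^sup>2 * (u \<bullet> u) + 2 * (1 + c) * s * (u \<bullet> v) + s\<^sup>2 * (norm v)\<^sup>2"
    unfolding power2_norm_eq_inner
    by (simp add: inner_add_left inner_add_right inner_commute power2_eq_square algebra_simps)
  also have "\<dots> = (1 + u \<bullet> v)\<^sup>2 - s\<^sup>2 * (1 - (norm v)\<^sup>2)"
    unfolding k uu by algebra
  finally have "(norm (u \<oplus>\<^sub>E v))\<^sup>2 = ((1 + u \<bullet> v)\<^sup>2 - s\<^sup>2 * (1 - (norm v)\<^sup>2)) / (1 + u \<bullet> v)\<^sup>2"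
    unfolding eq norm_scaleR power_mult_distrib by (simp add: power_divide)
  then show ?thesis using pos s by (simp add: diff_divide_distrib)
qed

lemma norm_einstein_add_less:
  fixes u v :: "real ^ 'n"
  assumes u: "norm u < 1" and v: "norm v < 1"
  shows "norm (u \<oplus>\<^sub>E v) < 1"
proof -
  have "(norm u)\<^sup>2 < 1" "(norm v)\<^sup>2 < 1" using u v by (simp_all add: abs_square_less_1)
  then have "0 < 1 - (norm (u \<oplus>\<^sub>E v))\<^sup>2"
    unfolding norm_einstein_add[OF u v] using ball_inner_gt[OF u v]
    by (intro divide_pos_pos mult_pos_pos) auto
  then show ?thesis by (simp add: abs_square_less_1)
qed

lemma norm_einstein_add_commute:
  fixes u v :: "real ^ 'n"
  assumes u: "norm u < 1" and v: "norm v < 1"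
  shows "norm (u \<oplus>\<^sub>E v) = norm (v \<oplus>\<^sub>E u)"
proof -
  have "1 - (norm (u \<oplus>\<^sub>E v))\<^sup>2 = 1 - (norm (v \<oplus>\<^sub>E u))\<^sup>2"
    unfolding norm_einstein_add[OF u v] norm_einstein_add[OF v u] by (simp add: inner_commute mult.commute)
  then show ?thesis by simp
qed

lemma einstein_add_orthogonal:
  fixes u v :: "real ^ 'n"
  assumes "u \<bullet> v = 0"
  shows "u \<oplus>\<^sub>E v = u + sqrt (1 - (norm u)\<^sup>2) *\<^sub>R v"
  using assms by (simp add: einstein_add_def)

lemma einstein_add_collinear:
  fixes e :: "real ^ 'n"
  assumes e: "norm e = 1" and a: "\<bar>a\<bar> < 1"
  shows "(a *\<^sub>R e) \<oplus>\<^sub>E (b *\<^sub>R e) = ((a + b) / (1 + a * b)) *\<^sub>R e"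
proof -
  define s where "s = sqrt (1 - a\<^sup>2)"
  have "a\<^sup>2 < 1" using a by (simp add: abs_square_less_1)
  then have s: "0 < s" "s\<^sup>2 = 1 - a\<^sup>2" by (simp_all add: s_def)
  have ab: "(a *\<^sub>R e) \<bullet> (b *\<^sub>R e) = a * b" using e by (simp add: dot_square_norm)
  \<comment> \<open>Since \<open>a\<^sup>2 = (1 - s) * (1 + s)\<close>, the two corrections to
    \<open>b\<close> add up to exactly \<open>b\<close>; what remains is the addition law of
    tanh.\<close>
  have "s * b + a * b / (1 + s) * a = (s * b + s\<^sup>2 * b + b * a\<^sup>2) / (1 + s)"
    using s by (simp add: field_simps power2_eq_square)
  also have "s * b + s\<^sup>2 * b + b * a\<^sup>2 = b * (1 + s)"
    unfolding s(2) by (simp add: algebra_simps)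
  also have "\<dots> / (1 + s) = b" using s by simp
  finally have *: "s * b + a * b / (1 + s) * a = b" .
  have "(a *\<^sub>R e) \<oplus>\<^sub>E (b *\<^sub>R e) = (1 / (1 + a * b)) *\<^sub>R ((a + (s * b + a * b / (1 + s) * a)) *\<^sub>R e)"
    unfolding einstein_add_def ab using e by (simp add: s_def scaleR_add_left)
  then show ?thesis unfolding * by simp
qed

section \<open>Rapidity coordinates\<close>

text \<open>The value 1 at 0 removes the singularity, so the radial maps built from
  \<open>tanhc\<close> and \<open>artanhc\<close> are continuous at the origin.\<close>

definition tanhc :: "real \<Rightarrow> real" where
  "tanhc r = (if r = 0 then 1 else tanh r / r)"

definition artanhc :: "real \<Rightarrow> real" where
  "artanhc r = (if r = 0 then 1 else artanh r / r)"

lemma isCont_tanhc: "isCont tanhc r"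
proof (cases "r = 0")
  case True
  \<comment> \<open>At 0, \<open>tanh r / r\<close> is the difference quotient of tanh.\<close>
  have "(tanh has_field_derivative 1) (at (0::real))"
    by (auto intro!: derivative_eq_intros)
  then have "((\<lambda>r. tanh r / r) \<longlongrightarrow> 1) (at (0::real))"
    by (simp add: has_field_derivative_iff)
  then have "(tanhc \<longlongrightarrow> 1) (at 0)"
    by (rule Lim_transform_eventually) (auto simp: eventually_at_filter tanhc_def)
  then show ?thesis using True by (simp add: isCont_def tanhc_def)
next
  case False
  then have "isCont (\<lambda>r. tanh r / r) r" by (intro continuous_intros) auto
  moreover have "\<forall>\<^sub>F r in nhds r. tanh r / r = tanhc r"
    using t1_space_nhds[OF False] by eventually_elim (simp add: tanhc_def)
  ultimately show ?thesis using isCont_cong[of "\<lambda>r. tanh r / r" tanhc r] by simp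
qed

lemma isCont_artanhc:
  assumes r: "\<bar>r\<bar> < 1"
  shows "isCont artanhc r"
proof (cases "r = 0")
  case True
  have "(artanh has_field_derivative 1) (at (0::real))"
    by (auto intro!: derivative_eq_intros)
  then have "((\<lambda>r. artanh r / r) \<longlongrightarrow> 1) (at (0::real))"
    by (simp add: has_field_derivative_iff)
  then have "(artanhc \<longlongrightarrow> 1) (at 0)"
    by (rule Lim_transform_eventually) (auto simp: eventually_at_filter artanhc_def)
  then show ?thesis using True by (simp add: isCont_def artanhc_def)
next
  case False
  then have "isCont (\<lambda>r. artanh r / r) r" using r by (intro continuous_intros) auto
  moreover have "\<forall>\<^sub>F r in nhds r. artanh r / r = artanhc r"
    using t1_space_nhds[OF False] by eventually_elim (simp add: artanhc_def)
  ultimately show ?thesis using isCont_cong[of "\<lambda>r. artanh r / r" artanhc r] by simp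
qed

lemma tanhc_pos: "0 < tanhc r"
  by (simp add: tanhc_def zero_less_divide_iff linorder_neq_iff)

lemma tanh_artanh_real:
  assumes r: "\<bar>r\<bar> < (1::real)"
  shows "tanh (artanh r) = r"
proof -
  \<comment> \<open>\<open>artanh r\<close> is half of \<open>ln q\<close>, that is
    \<open>ln (sqrt q)\<close>, and tanh of a logarithm is rational in the square of its
    argument.\<close>
  define q where "q = (1 + r) / (1 - r)"
  have q: "0 < q" using r by (simp add: q_def)
  have "tanh (artanh r) = tanh (ln (sqrt q))"
    using q by (simp add: artanh_def q_def[symmetric] ln_sqrt)
  also have "\<dots> = (q - 1) / (q + 1)"
    using q by (simp add: tanh_ln_real)
  also have "\<dots> = r" using r by (simp add: q_def field_simps)
  finally show ?thesis .
qed

definition of_rapidity :: "'a::real_normed_vector \<Rightarrow> 'a" where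
  "of_rapidity x = tanhc (norm x) *\<^sub>R x"

definition rapidity :: "'a::real_normed_vector \<Rightarrow> 'a" where
  "rapidity u = artanhc (norm u) *\<^sub>R u"

lemma norm_of_rapidity: "norm (of_rapidity x) = tanh (norm x)"
proof -
  have "norm (of_rapidity x) = tanhc (norm x) * norm x"
    using tanhc_pos[of "norm x"] by (simp add: of_rapidity_def abs_of_pos)
  then show ?thesis by (simp add: tanhc_def)
qed

lemma norm_of_rapidity_less: "norm (of_rapidity x) < 1"
  unfolding norm_of_rapidity by (rule tanh_real_lt_1)

lemma rapidity_of_rapidity [simp]: "rapidity (of_rapidity x) = x"
proof (cases "x = 0")
  case False
  then have "artanhc (tanh (norm x)) * tanhc (norm x) = 1"
    by (simp add: artanhc_def tanhc_def artanh_tanh_real)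
  then show ?thesis
    unfolding rapidity_def norm_of_rapidity by (simp add: of_rapidity_def)
qed (simp add: rapidity_def of_rapidity_def)

lemma norm_rapidity:
  assumes "norm u < 1"
  shows "tanh (norm (rapidity u)) = norm u"
proof (cases "u = 0")
  case False
  \<comment> \<open>Positivity removes the absolute value in the norm of the scaled vector.\<close>
  have "0 < artanh (norm u)"
    using False assms tanh_artanh_real[of "norm u"] by (metis abs_norm_cancel tanh_real_pos_iff zero_less_norm_iff)
  then have "norm (rapidity u) = artanh (norm u)" using False
    by (simp add: rapidity_def artanhc_def)
  then show ?thesis using assms by (simp add: tanh_artanh_real)
qed (simp add: rapidity_def)

lemma of_rapidity_rapidity:
  assumes "norm u < 1"
  shows "of_rapidity (rapidity u) = u"
proof (cases "u = 0")
  case False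
  then have ne: "rapidity u \<noteq> 0" using norm_rapidity[OF assms] by auto
  have "of_rapidity (rapidity u) = (norm u / norm (rapidity u)) *\<^sub>R rapidity u"
    using ne norm_rapidity[OF assms] by (simp add: of_rapidity_def tanhc_def)
  also have "\<dots> = u"
  proof -
    have "0 < artanh (norm u)"
      using False assms tanh_artanh_real[of "norm u"] by (metis abs_norm_cancel tanh_real_pos_iff zero_less_norm_iff)
    then show ?thesis using False by (simp add: rapidity_def artanhc_def)
  qed
  finally show ?thesis .
qed (simp add: rapidity_def of_rapidity_def)

lemma of_rapidity_scaleR:
  assumes "norm e = 1"
  shows "of_rapidity (t *\<^sub>R e) = tanh t *\<^sub>R e"
proof -
  \<comment> \<open>The norm only sees \<open>\<bar>t\<bar>\<close>; for negative \<open>t\<close>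
    the oddness of tanh restores the sign.\<close>
  have "tanhc \<bar>t\<bar> * t = tanh t"
    by (cases "0 \<le> t") (auto simp: tanhc_def)
  then show ?thesis using assms by (simp add: of_rapidity_def)
qed

lemma continuous_on_of_rapidity: "continuous_on S of_rapidity"
proof -
  have "isCont of_rapidity x" for x :: 'a
  proof -
    have "isCont (\<lambda>x. tanhc (norm x)) x"
      by (rule isCont_o2[OF _ isCont_tanhc]) (rule continuous_norm[OF continuous_ident])
    from continuous_scaleR[OF this continuous_ident] show ?thesis
      unfolding of_rapidity_def .
  qed
  then show ?thesis by (simp add: continuous_at_imp_continuous_on)
qed

lemma isCont_rapidity: "norm u < 1 \<Longrightarrow> isCont rapidity u"
proof -
  assume "norm u < 1"
  then have "isCont artanhc (norm u)" by (intro isCont_artanhc) simp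
  then have "isCont (\<lambda>x. artanhc (norm x)) u"
    by (rule isCont_o2[rotated]) (rule continuous_norm[OF continuous_ident])
  from continuous_scaleR[OF this continuous_ident] show ?thesis
    unfolding rapidity_def .
qed

text \<open>Lines through the origin are one-parameter subgroups: in the unit direction of
  \<open>x\<close>, the collinear rule is the addition theorem of tanh.\<close>

lemma einstein_add_of_rapidity_collinear:
  fixes x :: "real ^ 'n"
  shows "of_rapidity (s *\<^sub>R x) \<oplus>\<^sub>E of_rapidity (t *\<^sub>R x) = of_rapidity ((s + t) *\<^sub>R x)"
proof (cases "x = 0")
  case True
  then show ?thesis by (simp add: of_rapidity_def einstein_add_def)
next
  case False
  define e where "e = x /\<^sub>R norm x"
  have e: "norm e = 1" "x = norm x *\<^sub>R e" using False by (simp_all add: e_def)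
  have *: "of_rapidity (r *\<^sub>R x) = tanh (r * norm x) *\<^sub>R e" for r
    using of_rapidity_scaleR[OF e(1), of "r * norm x"] e(2) by (metis scaleR_scaleR)
  have "\<bar>tanh (s * norm x)\<bar> < 1"
    using tanh_real_bounds[of "s * norm x"] by auto
  then show ?thesis
    unfolding * by (simp add: einstein_add_collinear[OF e(1)] tanh_add distrib_right)
qed

text \<open>A Lie-Trotter type formula: rescaling near the origin recovers vector addition from
  \<open>\<oplus>\<^sub>E\<close>. Both \<open>\<oplus>\<^sub>E\<close> and the rapidity maps agree
  with their linear parts to first order.\<close>

lemma rapidity_einstein_add_limit:
  fixes x y :: "real ^ 'n"
  shows "(\<lambda>n. real n *\<^sub>R rapidity (of_rapidity (x /\<^sub>R real n) \<oplus>\<^sub>E of_rapidity (y /\<^sub>R real n)))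
           \<longlonglongrightarrow> x + y"
proof -
  have inv: "(\<lambda>n. inverse (real n)) \<longlonglongrightarrow> 0"
    by (rule lim_inverse_n)
  have rap: "(\<lambda>n. z /\<^sub>R real n) \<longlonglongrightarrow> 0" for z :: "real ^ 'n"
    using tendsto_scaleR[OF inv tendsto_const[of z]] by simp
  have tc: "(\<lambda>n. tanhc (norm (z /\<^sub>R real n))) \<longlonglongrightarrow> 1" for z :: "real ^ 'n"
    using isCont_tendsto_compose[OF isCont_tanhc tendsto_norm_zero[OF rap[of z]]]
    by (simp add: tanhc_def)
  define U where "U n = of_rapidity (x /\<^sub>R real n)" for n
  define V where "V n = of_rapidity (y /\<^sub>R real n)" for n
  have lim0: "(\<lambda>n. of_rapidity (z /\<^sub>R real n)) \<longlonglongrightarrow> 0" for z :: "real ^ 'n"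
    using tendsto_scaleR[OF tc[of z] rap[of z]] by (simp add: of_rapidity_def)
  have lim1: "(\<lambda>n. real n *\<^sub>R of_rapidity (z /\<^sub>R real n)) \<longlonglongrightarrow> z" for z :: "real ^ 'n"
  proof (rule Lim_transform_eventually)
    show "(\<lambda>n. tanhc (norm (z /\<^sub>R real n)) *\<^sub>R z) \<longlonglongrightarrow> z"
      using tendsto_scaleR[OF tc[of z] tendsto_const[of z]] by simp
    \<comment> \<open>The equation is only claimed eventually: at \<open>n = 0\<close> the right
      side is 0 and the left side is \<open>z\<close>.\<close>
    show "\<forall>\<^sub>F n in sequentially. tanhc (norm (z /\<^sub>R real n)) *\<^sub>R z
            = real n *\<^sub>R of_rapidity (z /\<^sub>R real n)"
      using eventually_gt_at_top[of 0] by eventually_elim (simp add: of_rapidity_def)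
  qed
  have U0: "U \<longlonglongrightarrow> 0" and V0: "V \<longlonglongrightarrow> 0"
    and U1: "(\<lambda>n. real n *\<^sub>R U n) \<longlonglongrightarrow> x" and V1: "(\<lambda>n. real n *\<^sub>R V n) \<longlonglongrightarrow> y"
    using lim0 lim1 unfolding U_def V_def by auto
  define s where "s n = sqrt (1 - (norm (U n))\<^sup>2)" for n
  have ip: "(\<lambda>n. U n \<bullet> V n) \<longlonglongrightarrow> 0"
    using tendsto_inner[OF U0 V0] by simp
  have s: "s \<longlonglongrightarrow> 1"
    using tendsto_real_sqrt[OF tendsto_diff[OF tendsto_const[of 1] tendsto_power[OF tendsto_norm_zero[OF U0], of 2]]]
    unfolding s_def by simp
  have c: "(\<lambda>n. (U n \<bullet> V n) / (1 + s n)) \<longlonglongrightarrow> 0"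
    using tendsto_divide[OF ip tendsto_add[OF tendsto_const[of 1] s]] by simp
  have d: "(\<lambda>n. 1 / (1 + U n \<bullet> V n)) \<longlonglongrightarrow> 1"
    using tendsto_divide[OF tendsto_const[of 1] tendsto_add[OF tendsto_const[of 1] ip]] by simp
  have W1: "(\<lambda>n. real n *\<^sub>R (U n \<oplus>\<^sub>E V n)) \<longlonglongrightarrow> x + y"
  proof -
    have "(\<lambda>n. (1 / (1 + U n \<bullet> V n)) *\<^sub>R (real n *\<^sub>R U n + s n *\<^sub>R (real n *\<^sub>R V n)
             + ((U n \<bullet> V n) / (1 + s n)) *\<^sub>R (real n *\<^sub>R U n))) \<longlonglongrightarrow> 1 *\<^sub>R (x + 1 *\<^sub>R y + 0 *\<^sub>R x)"
      by (intro tendsto_intros U1 V1 s c d)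
    then show ?thesis
      by (simp add: einstein_add_def s_def scaleR_add_right mult.commute mult.left_commute)
  qed
  \<comment> \<open>Dividing the rescaled limit by \<open>n\<close> shows that the sums tend to 0,
    so their \<open>artanhc\<close> factor tends to 1.\<close>
  have "(\<lambda>n. inverse (real n) *\<^sub>R (real n *\<^sub>R (U n \<oplus>\<^sub>E V n))) \<longlonglongrightarrow> 0 *\<^sub>R (x + y)"
    by (intro tendsto_scaleR inv W1)
  then have "(\<lambda>n. inverse (real n) *\<^sub>R (real n *\<^sub>R (U n \<oplus>\<^sub>E V n))) \<longlonglongrightarrow> 0"
    by (simp only: scaleR_zero_left)
  moreover have "\<forall>\<^sub>F n in sequentially.
      inverse (real n) *\<^sub>R (real n *\<^sub>R (U n \<oplus>\<^sub>E V n)) = U n \<oplus>\<^sub>E V n"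
    using eventually_gt_at_top[of 0] by eventually_elim simp
  ultimately have W0: "(\<lambda>n. U n \<oplus>\<^sub>E V n) \<longlonglongrightarrow> 0"
    by (rule Lim_transform_eventually)
  have "(\<lambda>n. artanhc (norm (U n \<oplus>\<^sub>E V n))) \<longlonglongrightarrow> artanhc 0"
    by (rule isCont_tendsto_compose[OF isCont_artanhc tendsto_norm_zero[OF W0]]) simp
  from tendsto_scaleR[OF this W1] show ?thesis
    by (simp add: rapidity_def artanhc_def U_def V_def mult.commute)
qed

section \<open>Additive continuous maps\<close>

lemma linear_of_additive_continuous:
  fixes F :: "'a::real_normed_vector \<Rightarrow> 'b::real_normed_vector"
  assumes add: "\<And>x y. F (x + y) = F x + F y" and cont: "continuous_on UNIV F"
  shows "linear F"
proof -
  interpret additive F by unfold_locales (rule add)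
  have nat: "F (real n *\<^sub>R x) = real n *\<^sub>R F x" for n x
    by (induction n) (simp_all add: zero add scaleR_add_left)
  have int: "F (of_int k *\<^sub>R x) = of_int k *\<^sub>R F x" for k x
  proof (cases k rule: int_cases2)
    case (nonneg n)
    then show ?thesis using nat[of n x] by simp
  next
    case (nonpos n)
    then show ?thesis using nat[of n x] by (simp add: minus)
  qed
  have "F (r *\<^sub>R x) = r *\<^sub>R F x" for r x
  proof -
    \<comment> \<open>Cauchy's functional equation: the good scalars contain the rationals and, by
      continuity, form a closed set.\<close>
    have "\<rat> \<subseteq> {r. F (r *\<^sub>R x) = r *\<^sub>R F x}"
    proof
      fix r :: real
      assume "r \<in> \<rat>"
      then obtain a b :: int where b: "b > 0" and r: "r = of_int a / of_int b"
        using Rats_cases' by metis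
      have "of_int b *\<^sub>R F (r *\<^sub>R x) = F (of_int a *\<^sub>R x)"
        unfolding int[symmetric] using b r by simp
      also have "\<dots> = of_int b *\<^sub>R (r *\<^sub>R F x)" using b r int by simp
      finally show "r \<in> {r. F (r *\<^sub>R x) = r *\<^sub>R F x}"
        using b by (simp del: scaleR_scaleR)
    qed
    moreover have "closed {r. F (r *\<^sub>R x) = r *\<^sub>R F x}"
      by (intro closed_Collect_eq continuous_intros continuous_on_compose2[OF cont]) auto
    ultimately have "closure \<rat> \<subseteq> {r. F (r *\<^sub>R x) = r *\<^sub>R F x}" by (rule closure_minimal)
    then show ?thesis using Rats_closure_real by auto
  qed
  with add show ?thesis by (intro linearI)
qed

section \<open>Endomorphisms\<close>

text \<open>Here \<open>F\<close> is \<open>f\<close> in rapidity coordinates. It commutes with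
  natural multiples because lines are subgroups, so it maps the approximants of \<open>x + y\<close>
  to those of \<open>F x + F y\<close>; continuity and uniqueness of limits make it
  additive.\<close>

lemma einstein_endomorphism_rapidity_linear:
  fixes f :: "real ^ 'n \<Rightarrow> real ^ 'n"
  assumes cont: "continuous_on (ball 0 1) f" and endo: "einstein_endomorphism f"
  obtains A where "linear A" "\<And>x. f (of_rapidity x) = of_rapidity (A x)"
proof
  define F where "F x = rapidity (f (of_rapidity x))" for x
  have ball: "norm (f u) < 1" if "norm u < 1" for u
    using endo that by (auto simp: einstein_endomorphism_def Pi_iff)
  have hom: "f (u \<oplus>\<^sub>E v) = f u \<oplus>\<^sub>E f v" if "norm u < 1" "norm v < 1" for u v
    using endo that by (auto simp: einstein_endomorphism_def)
  show fF: "f (of_rapidity x) = of_rapidity (F x)" for x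
    unfolding F_def by (rule of_rapidity_rapidity[symmetric], rule ball, rule norm_of_rapidity_less)
  have contF: "continuous_on UNIV F"
    unfolding F_def
  proof (rule continuous_on_compose2[of "ball 0 1" rapidity])
    show "continuous_on (ball 0 1) (rapidity :: real ^ 'n \<Rightarrow> _)"
      by (auto intro!: continuous_at_imp_continuous_on isCont_rapidity)
    show "continuous_on UNIV (\<lambda>x. f (of_rapidity x))"
      by (rule continuous_on_compose2[OF cont continuous_on_of_rapidity])
         (auto simp: norm_of_rapidity_less)
  qed (auto intro!: ball norm_of_rapidity_less)
  have F_add: "of_rapidity (F x) \<oplus>\<^sub>E of_rapidity (F y)
      = of_rapidity (F (rapidity (of_rapidity x \<oplus>\<^sub>E of_rapidity y)))" for x y
    unfolding fF[symmetric]
    by (simp add: hom of_rapidity_rapidity norm_einstein_add_less norm_of_rapidity_less)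
  have Fnat: "F (real n *\<^sub>R x) = real n *\<^sub>R F x" for n x
  proof (induction n)
    case 0
    \<comment> \<open>The homomorphism law at the sum of two zeros doubles \<open>F 0\<close>
      without changing it.\<close>
    have "of_rapidity (2 *\<^sub>R F 0) = of_rapidity (F 0)"
      using F_add[of 0 0] einstein_add_of_rapidity_collinear[of 1 "F 0" 1]
        einstein_add_of_rapidity_collinear[of 1 "0 :: real ^ 'n" 1] by simp
    then have "2 *\<^sub>R F 0 = F 0" by (metis rapidity_of_rapidity)
    then show ?case by (simp add: scaleR_2)
  next
    case (Suc n)
    have "of_rapidity (F (real (Suc n) *\<^sub>R x)) = of_rapidity (F (real n *\<^sub>R x)) \<oplus>\<^sub>E of_rapidity (F x)"
      using F_add[of "real n *\<^sub>R x" x] einstein_add_of_rapidity_collinear[of "real n" x 1]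
      by (simp add: add.commute)
    also have "\<dots> = of_rapidity (real (Suc n) *\<^sub>R F x)"
      unfolding Suc using einstein_add_of_rapidity_collinear[of "real n" "F x" 1]
      by (simp add: add.commute)
    finally show ?case by (metis rapidity_of_rapidity)
  qed
  have Fdiv: "F (x /\<^sub>R real n) = F x /\<^sub>R real n" if "n > 0" for n x
    using Fnat[of n "x /\<^sub>R real n"] that by simp
  have add: "F (x + y) = F x + F y" for x y
  proof -
    let ?z = "\<lambda>n. real n *\<^sub>R rapidity (of_rapidity (x /\<^sub>R real n) \<oplus>\<^sub>E of_rapidity (y /\<^sub>R real n))"
    have "(\<lambda>n. F (?z n)) \<longlonglongrightarrow> F (x + y)"
      using contF rapidity_einstein_add_limit[of x y]
      by (auto simp: continuous_on_eq_continuous_at intro: isCont_tendsto_compose)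
    moreover have "\<forall>\<^sub>F n in sequentially. F (?z n)
        = real n *\<^sub>R rapidity (of_rapidity (F x /\<^sub>R real n) \<oplus>\<^sub>E of_rapidity (F y /\<^sub>R real n))"
      using eventually_gt_at_top[of 0]
      by eventually_elim (simp only: Fnat Fdiv[symmetric] F_add rapidity_of_rapidity)
    ultimately have "(\<lambda>n. real n *\<^sub>R rapidity (of_rapidity (F x /\<^sub>R real n) \<oplus>\<^sub>E of_rapidity (F y /\<^sub>R real n)))
        \<longlonglongrightarrow> F (x + y)"
      by (rule Lim_transform_eventually)
    then show ?thesis
      using rapidity_einstein_add_limit[of "F x" "F y"] by (rule LIMSEQ_unique)
  qed
  show "linear F" using linear_of_additive_continuous[OF add contF] .
qed

section \<open>Endomorphisms that are linear in rapidity coordinates\<close>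

locale rapidity_linear_endomorphism =
  fixes A f :: "real ^ 'n \<Rightarrow> real ^ 'n"
  assumes linear: "linear A"
    and f_of_rapidity: "f (of_rapidity x) = of_rapidity (A x)"
    and hom: "\<lbrakk>norm u < 1; norm v < 1\<rbrakk> \<Longrightarrow> f (u \<oplus>\<^sub>E v) = f u \<oplus>\<^sub>E f v"
begin

lemma f_eq: "norm u < 1 \<Longrightarrow> f u = of_rapidity (A (rapidity u))"
  using f_of_rapidity[of "rapidity u"] by (simp add: of_rapidity_rapidity)

text \<open>Injectivity of tanh gives equal norms for the images of the two rapidities. As
  \<open>u\<close> and \<open>v\<close> have equal norm, their rapidities are the same nonzero
  multiple of them, which cancels.\<close>

lemma norm_A_cong:
  assumes u: "norm u < 1" and uv: "norm u = norm v" and f: "norm (f u) = norm (f v)"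
  shows "norm (A u) = norm (A v)"
proof (cases "u = 0")
  case True
  then show ?thesis using uv by simp
next
  case False
  have "norm (A (rapidity u)) = norm (A (rapidity v))"
    using f u uv by (simp add: f_eq norm_of_rapidity)
  moreover have "rapidity u \<noteq> 0" using False norm_rapidity[OF u] by auto
  ultimately show ?thesis
    using uv by (auto simp: rapidity_def linear_cmul[OF linear])
qed

text \<open>The norm of \<open>u \<oplus>\<^sub>E v\<close> is symmetric in \<open>u\<close> and \<open>v\<close>; comparing the two orders for
  orthogonal arguments gives the relations from which conformality of \<open>A\<close> is read off.\<close>
lemma orthonormal_relation:
  assumes e: "norm e = 1" "norm d = 1" "e \<bullet> d = 0" and ab: "\<bar>a\<bar> < 1" "\<bar>b\<bar> < 1"
  shows "a\<^sup>2 * b\<^sup>2 * ((norm (A e))\<^sup>2 - (norm (A d))\<^sup>2)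
    + 2 * a * b * (sqrt (1 - a\<^sup>2) - sqrt (1 - b\<^sup>2)) * (A e \<bullet> A d) = 0"
proof -
  let ?u = "a *\<^sub>R e" and ?v = "b *\<^sub>R d"
  have nu: "norm ?u < 1" and nv: "norm ?v < 1" using e ab by simp_all
  define s t where "s = sqrt (1 - a\<^sup>2)" and "t = sqrt (1 - b\<^sup>2)"
  have "a\<^sup>2 < 1" "b\<^sup>2 < 1" using ab by (simp_all add: abs_square_less_1)
  then have st: "s\<^sup>2 = 1 - a\<^sup>2" "t\<^sup>2 = 1 - b\<^sup>2" by (simp_all add: s_def t_def)
  have w: "?u \<oplus>\<^sub>E ?v = a *\<^sub>R e + (s * b) *\<^sub>R d" "?v \<oplus>\<^sub>E ?u = b *\<^sub>R d + (t * a) *\<^sub>R e"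
    using e by (simp_all add: einstein_add_orthogonal s_def t_def inner_commute)
  have fball: "norm (f u) < 1" if "norm u < 1" for u
    using that by (simp add: f_eq norm_of_rapidity_less)
  have "norm (A (?u \<oplus>\<^sub>E ?v)) = norm (A (?v \<oplus>\<^sub>E ?u))"
  proof (intro norm_A_cong norm_einstein_add_less norm_einstein_add_commute nu nv)
    have "norm (f ?u \<oplus>\<^sub>E f ?v) = norm (f ?v \<oplus>\<^sub>E f ?u)"
      by (intro norm_einstein_add_commute fball nu nv)
    then show "norm (f (?u \<oplus>\<^sub>E ?v)) = norm (f (?v \<oplus>\<^sub>E ?u))"
      unfolding hom[OF nu nv] hom[OF nv nu] .
  qed
  then have "(norm (a *\<^sub>R A e + (s * b) *\<^sub>R A d))\<^sup>2 = (norm (b *\<^sub>R A d + (t * a) *\<^sub>R A e))\<^sup>2"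
    unfolding w by (simp add: linear_add[OF linear] linear_cmul[OF linear])
  then have "a\<^sup>2 * (A e \<bullet> A e) + 2 * a * s * b * (A e \<bullet> A d) + s\<^sup>2 * b\<^sup>2 * (A d \<bullet> A d)
     = b\<^sup>2 * (A d \<bullet> A d) + 2 * b * t * a * (A e \<bullet> A d) + t\<^sup>2 * a\<^sup>2 * (A e \<bullet> A e)"
    unfolding power2_norm_eq_inner
    by (simp add: inner_add_left inner_add_right inner_commute[of "A d" "A e"] power2_eq_square algebra_simps)
  then show ?thesis
    unfolding st s_def[symmetric] t_def[symmetric] power2_norm_eq_inner by (simp add: algebra_simps)
qed

lemma norm_A_orthonormal:
  assumes e: "norm e = 1" "norm d = 1" "e \<bullet> d = 0"
  shows "norm (A e) = norm (A d)"
  \<comment> \<open>Equal parameters kill the mixed term.\<close>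
  using orthonormal_relation[OF e, of "1/2" "1/2"] by simp

lemma A_orthogonal:
  assumes e: "norm e = 1" "norm d = 1" "e \<bullet> d = 0"
  shows "A e \<bullet> A d = 0"
proof -
  \<comment> \<open>With equal norms only the mixed term is left; a Pythagorean pair makes its
    coefficient rational and nonzero.\<close>
  have "sqrt (16/25) = (4/5::real)" "sqrt (9/25) = (3/5::real)"
    by (simp_all add: real_sqrt_divide real_sqrt_unique)
  then show ?thesis
    using orthonormal_relation[OF e, of "3/5" "4/5"] norm_A_orthonormal[OF e]
    by (simp add: power2_eq_square)
qed

text \<open>With \<open>u = tanh 1 e\<close>, \<open>v = tanh 1 d\<close>, the direction of \<open>f (u \<oplus>\<^sub>E v)\<close> is that of \<open>A (u \<oplus>\<^sub>E v)\<close>,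
  and this can agree with \<open>f u \<oplus>\<^sub>E f v\<close> only if \<open>A\<close> preserves the rapidity of \<open>u\<close>.\<close>
lemma norm_A_01:
  assumes e: "norm e = 1" "norm d = 1" "e \<bullet> d = 0"
  shows "norm (A e) = 0 \<or> norm (A e) = 1"
proof (rule disjCI)
  assume "norm (A e) \<noteq> 1"
  show "norm (A e) = 0"
  proof (rule ccontr)
    assume ne: "norm (A e) \<noteq> 0"
    define l a T where "l = norm (A e)" and "a = tanh (1::real)" and "T = tanh l"
    have l: "0 < l" "norm (A d) = l" using ne norm_A_orthonormal[OF e] by (auto simp: l_def)
    have pos: "0 < a" "a < 1" "0 < T" "T < 1"
      using l by (simp_all add: a_def T_def tanh_real_lt_1)
    have sq: "a\<^sup>2 < 1" "T\<^sup>2 < 1" using pos by (simp_all add: abs_square_less_1)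
    have pq: "A e \<bullet> A d = 0" by (rule A_orthogonal[OF e])
    \<comment> \<open>The choice \<open>a = tanh 1\<close> makes the rapidity of
      \<open>a *\<^sub>R c\<close> equal to \<open>c\<close> itself.\<close>
    have fe: "f (a *\<^sub>R c) = (T / l) *\<^sub>R A c" if "norm c = 1" "norm (A c) = l" for c
    proof -
      have "f (a *\<^sub>R c) = of_rapidity (A c)"
        using f_of_rapidity[of c] of_rapidity_scaleR[OF that(1), of 1] by (simp add: a_def)
      then show ?thesis using that l by (simp add: of_rapidity_def tanhc_def T_def)
    qed
    have fu: "f (a *\<^sub>R e) = (T / l) *\<^sub>R A e" and fv: "f (a *\<^sub>R d) = (T / l) *\<^sub>R A d"
      using fe e l by (auto simp: l_def)
    let ?w = "(a *\<^sub>R e) \<oplus>\<^sub>E (a *\<^sub>R d)"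
    have w: "?w = a *\<^sub>R e + (sqrt (1 - a\<^sup>2) * a) *\<^sub>R d"
      using e by (simp add: einstein_add_orthogonal)
    have nw: "norm ?w < 1" using e pos by (intro norm_einstein_add_less) simp_all
    \<comment> \<open>The rapidity maps only rescale, so \<open>f ?w\<close> is a multiple of
      \<open>A ?w\<close>; only the existence of this factor matters.\<close>
    define k where "k = tanhc (norm (A (rapidity ?w))) * artanhc (norm ?w)"
    have "f ?w = k *\<^sub>R A ?w"
      unfolding f_eq[OF nw] of_rapidity_def k_def
      by (subst (2) rapidity_def) (simp add: linear_cmul[OF linear])
    also have "\<dots> = (k * a) *\<^sub>R A e + (k * a * sqrt (1 - a\<^sup>2)) *\<^sub>R A d"
      unfolding w by (simp add: linear_add[OF linear] linear_cmul[OF linear] scaleR_add_right mult_ac)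
    finally have f1: "f ?w = (k * a) *\<^sub>R A e + (k * a * sqrt (1 - a\<^sup>2)) *\<^sub>R A d" .
    have "f ?w = f (a *\<^sub>R e) \<oplus>\<^sub>E f (a *\<^sub>R d)"
      using e pos by (intro hom) simp_all
    also have "\<dots> = (T / l) *\<^sub>R A e + (T / l * sqrt (1 - T\<^sup>2)) *\<^sub>R A d"
      unfolding fu fv using pq l pos
      by (simp add: einstein_add_orthogonal l_def[symmetric] mult.commute)
    finally have f2: "f ?w = (T / l) *\<^sub>R A e + (T / l * sqrt (1 - T\<^sup>2)) *\<^sub>R A d" .
    have ipe: "A e \<bullet> A e = l\<^sup>2" and ipd: "A d \<bullet> A d = l\<^sup>2"
      using l by (simp_all add: dot_square_norm l_def)
    \<comment> \<open>Pairing with the orthogonal nonzero vectors \<open>A e\<close> and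
      \<open>A d\<close> compares the coefficients of the two expressions. Their ratios force
      \<open>a = T\<close>, hence \<open>l = 1\<close>.\<close>
    have "f ?w \<bullet> A e = (k * a) * l\<^sup>2"
      unfolding f1 using pq by (simp add: inner_add_left ipe inner_commute[of "A d"])
    moreover have "f ?w \<bullet> A e = (T / l) * l\<^sup>2"
      unfolding f2 using pq by (simp add: inner_add_left ipe inner_commute[of "A d"])
    ultimately have ka: "k * a = T / l" using l(1) by (simp del: times_divide_eq_left)
    have "f ?w \<bullet> A d = (k * a * sqrt (1 - a\<^sup>2)) * l\<^sup>2"
      unfolding f1 using pq by (simp add: inner_add_left ipd)
    moreover have "f ?w \<bullet> A d = (T / l * sqrt (1 - T\<^sup>2)) * l\<^sup>2"
      unfolding f2 using pq by (simp add: inner_add_left ipd)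
    ultimately have "sqrt (1 - a\<^sup>2) = sqrt (1 - T\<^sup>2)" using l pos unfolding ka by simp
    then have "a = T" using pos by (simp add: power2_eq_iff)
    then have "l = 1" by (simp add: a_def T_def)
    then show False using \<open>norm (A e) \<noteq> 1\<close> by (simp add: l_def)
  qed
qed

lemma zero_or_orthogonal:
  assumes "CARD('n) \<ge> 2"
  shows "A = (\<lambda>x. 0) \<or> orthogonal_transformation A"
proof -
  have orth: "axis i 1 \<bullet> (axis j 1 :: real ^ 'n) = 0" if "i \<noteq> j" for i j
    using that by (simp add: inner_axis_axis)
  have const: "norm (A (axis i 1)) = norm (A (axis j 1))" for i j
    using norm_A_orthonormal[OF _ _ orth, of i j] by (cases "i = j") simp_all
  \<comment> \<open>This is where dimension at least 2 enters: the dichotomy for the norm needs a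
    second, orthogonal axis.\<close>
  have other: "\<exists>j. j \<noteq> i" for i :: 'n
  proof (rule ccontr)
    assume "\<not> ?thesis"
    then have "(UNIV :: 'n set) = {i}" by auto
    then have "CARD('n) = card {i}" by (rule arg_cong)
    then show False using assms by simp
  qed
  define i0 :: 'n where "i0 = undefined"
  obtain j0 where "j0 \<noteq> i0" using other by blast
  then have "norm (A (axis i0 1)) = 0 \<or> norm (A (axis i0 1)) = 1"
    using norm_A_01[OF _ _ orth, of i0 j0] by auto
  then show ?thesis
  proof
    assume "norm (A (axis i0 1)) = 0"
    then have "A (axis i 1) = 0" for i using const[of i i0] by simp
    then have "A b = 0" if "b \<in> Basis" for b
      using that by (auto simp: Basis_vec_def)
    then have "A = (\<lambda>x. 0)"
      by (intro linear_eq_stdbasis[OF linear linear_zero])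
    then show ?thesis ..
  next
    assume "norm (A (axis i0 1)) = 1"
    then have one: "norm (A (axis i 1)) = 1" for i using const[of i i0] by simp
    \<comment> \<open>The images of the axes are the columns of the matrix, so their orthonormality
      is orthogonality of the matrix.\<close>
    have col: "column i (matrix A) = A (axis i 1)" for i
      by (simp add: column_def matrix_def vec_eq_iff)
    have "orthogonal_matrix (matrix A)"
      unfolding orthogonal_matrix_orthonormal_columns col
      using one A_orthogonal[OF _ _ orth] by (auto simp: orthogonal_def)
    then show ?thesis
      using linear by (simp add: orthogonal_transformation_matrix)
  qed
qed

end

section \<open>Orthogonal maps as endomorphisms, and the classification\<close>

lemma orthogonal_transformation_einstein_add:
  fixes T :: "real ^ 'n \<Rightarrow> real ^ 'n"
  assumes "orthogonal_transformation T"
  shows "T (u \<oplus>\<^sub>E v) = T u \<oplus>\<^sub>E T v"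
proof -
  have T: "linear T" "T x \<bullet> T y = x \<bullet> y" "norm (T x) = norm x" for x y
    using assms by (auto simp: orthogonal_transformation_def orthogonal_transformation_norm[OF assms])
  show ?thesis
    by (simp add: einstein_add_def T linear_add[OF T(1)] linear_cmul[OF T(1)])
qed

theorem theorem6:
  fixes f :: "real ^ 'n \<Rightarrow> real ^ 'n"
  assumes "CARD('n) \<ge> 2"
  shows "continuous_on (ball 0 1) f \<and> einstein_endomorphism f \<longleftrightarrow>
     (\<forall>u\<in>ball 0 1. f u = 0) \<or>
     (\<exists>T. orthogonal_transformation T \<and> (\<forall>u\<in>ball 0 1. f u = T u))"
proof (intro iffI; (elim disjE exE conjE)?)
  assume cont: "continuous_on (ball 0 1) f" and endo: "einstein_endomorphism f"
  obtain A where A: "linear A" "\<And>x. f (of_rapidity x) = of_rapidity (A x)"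
    using einstein_endomorphism_rapidity_linear[OF cont endo] by blast
  interpret rapidity_linear_endomorphism A f
    using A endo by (intro rapidity_linear_endomorphism.intro) (auto simp: einstein_endomorphism_def)
  show "(\<forall>u\<in>ball 0 1. f u = 0) \<or> (\<exists>T. orthogonal_transformation T \<and> (\<forall>u\<in>ball 0 1. f u = T u))"
    using zero_or_orthogonal[OF assms]
  proof
    assume "A = (\<lambda>x. 0)"
    then show ?thesis by (auto simp: f_eq of_rapidity_def)
  next
    assume orth: "orthogonal_transformation A"
    have "f u = A u" if "norm u < 1" for u
    proof -
      \<comment> \<open>\<open>A\<close> preserves norms, so it commutes with the radial map
        \<open>of_rapidity\<close>, and the change of coordinates cancels.\<close>
      have "f u = A (of_rapidity (rapidity u))"
        using that orth by (simp add: f_eq of_rapidity_def orthogonal_transformation_norm linear_cmul[OF linear])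
      then show ?thesis using that by (simp add: of_rapidity_rapidity)
    qed
    then show ?thesis using orth by auto
  qed
next
  assume zero: "\<forall>u\<in>ball 0 1. f u = 0"
  then have "continuous_on (ball 0 1) f"
    using continuous_on_cong[of "ball 0 1" "ball 0 1" f "\<lambda>_. 0"] by simp
  moreover have "einstein_endomorphism f"
    \<comment> \<open>Closure of the ball lets \<open>f\<close> be evaluated at the sum; it remains
      that 0 is idempotent for \<open>\<oplus>\<^sub>E\<close>.\<close>
    using zero by (auto simp: einstein_endomorphism_def norm_einstein_add_less)
       (simp add: einstein_add_def)
  ultimately show "continuous_on (ball 0 1) f \<and> einstein_endomorphism f" ..
next
  fix T
  assume orth: "orthogonal_transformation T" and T: "\<forall>u\<in>ball 0 1. f u = T u"
  have "continuous_on (ball 0 1) T"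
    using orth by (simp add: orthogonal_transformation_def linear_continuous_on linear_conv_bounded_linear)
  then have "continuous_on (ball 0 1) f"
    using continuous_on_cong[of "ball 0 1" "ball 0 1" f T] T by simp
  moreover have "einstein_endomorphism f"
    using T orth by (auto simp: einstein_endomorphism_def norm_einstein_add_less
        orthogonal_transformation_norm orthogonal_transformation_einstein_add)
  ultimately show "continuous_on (ball 0 1) f \<and> einstein_endomorphism f" ..
qed

end
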